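(* Let $L\ge2$, ${\boldsymbol n}=(n_0,n_1,\dots,n_{L-1})\in(\mathbb{Z}_{\ge0})^L$ and $0\le k\le L$. Then the block-Toeplitz determinant $\Delta^{(k)}({\boldsymbol n})$ of hypergeometric integrals $h^a_j$ (see the context) is expressed as the iterated hypergeometric integral $$\Delta^{(k)}({\boldsymbol n})=\prod_{a=0}^{L-1}\frac{1}{n_a!}\int\left(\prod_{a=0}^{k-1}\prod_{j=1}^{n_a}s_{a,j}\right)\left(\prod_{(a,b)>(c,d)}(s_{a,b}-s_{c,d})\right)\prod_{a=0}^{L-1}\left(\prod_{1\le b<c\le n_a}(s_{a,b}-s_{a,c})\right)\prod_{j=1}^{n_a}d\mu_a(s_{a,j}),$$ where the integration is over the $|{\boldsymbol n}|$ variables $s_{a,b}$ $(0\le a\le L-1,\ 1\le b\le n_a)$, and $(a,b)>(c,d)$ means "$a>c$" or "$a=c$ and $b>d$", the corresponding product being over all such pairs of indices of the variables.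
   Context: With parameters $\alpha_1,\dots,\alpha_{L-1},\gamma_1,\dots,\gamma_{L-1},\beta_1,\dots,\beta_N$, variables $x_1,\dots,x_N$ and $t_0=\gamma_L=1$ put $$U({\boldsymbol t})=\prod_{l=1}^{L-1}t_l^{\alpha_l-\gamma_{l+1}}(t_{l-1}-t_l)^{\gamma_l-\alpha_l}\prod_{i=1}^N(1-x_it_{L-1})^{-\beta_i},\qquad {\boldsymbol t}=(t_1,\dots,t_{L-1}).$$ Let $c$ be a cycle for $U$ on which $t_{L-1}$ stays bounded, for instance the simplex $\{0\le t_{L-1}\le\cdots\le t_1\le1\}\subset\mathbb{R}^{L-1}$ (integrals taken where convergent). Write $\mathrm{pr}(c)=\{t_{L-1}\mid(t_1,\dots,t_{L-1})\in c\}$ and $c|t_{L-1}=\{(t_1,\dots,t_{L-2})\mid(t_1,\dots,t_{L-1})\in c\}$. Define the (complex) "measures" on $\mathrm{pr}(c)$ $$d\mu_0(t_{L-1})=\left(\int_{c|t_{L-1}}\frac{U({\boldsymbol t})\,dt_1\cdots dt_{L-2}}{\prod_{l=1}^{L-1}(t_{l-1}-t_l)}\right)dt_{L-1},\qquad d\mu_k(t_{L-1})=\left(\int_{c|t_{L-1}}\frac{U({\boldsymbol t})\,dt_1\cdots dt_{L-2}}{\prod_{1\le l\le L-1,\ l\ne k}(t_{l-1}-t_l)}\right)dt_{L-1}\quad(1\le k\le L-1),$$ and their moments $h^a_j=\int_{\mathrm{pr}(c)}s^j\,d\mu_a(s)$ for $j\ge0$, $0\le a\le L-1$, with $h^a_j=0$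 for $j<0$. The multiple integral in the claim is taken with each $s_{a,j}$ running over $\mathrm{pr}(c)$ with respect to $d\mu_a$. $A^i_j(k,l)$ is the $k\times l$ matrix with $(r,s)$ entry $h^i_{j+r-s}$ $(1\le r\le k,\ 1\le s\le l)$, $|{\boldsymbol n}|=\sum_{i=0}^{L-1}n_i$, and $$\Delta^{(k)}({\boldsymbol n})=\det\left[A^0_{n_0}(|{\boldsymbol n}|,n_0)\ \cdots\ A^{k-1}_{n_{k-1}}(|{\boldsymbol n}|,n_{k-1})\ \ A^{k}_{n_k-1}(|{\boldsymbol n}|,n_k)\ \cdots\ A^{L-1}_{n_{L-1}-1}(|{\boldsymbol n}|,n_{L-1})\right],$$ with $\Delta^{(k)}({\boldsymbol 0})=1$. *)

theory Defs
  imports "HOL-Analysis.Analysis" "Jordan_Normal_Form.Determinant"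
begin

text \<open>
  The multivalued function \<open>U\<close> is integrated over \<^emph>\<open>twisted chains\<close>: finite complex linear
  combinations of parametrised cells, each loaded with a branch of \<open>U\<close> along it.  Inner
  integrals over \<open>c|t\<^bsub>L-1\<^esub>\<close> and outer ones over \<open>pr(c)\<close> require a chain that is fibred over a
  path of \<open>t\<^bsub>L-1\<^esub>\<close>.  So a cell has one real parameter \<open>v\<close> for \<open>t\<^bsub>L-1\<^esub>\<close> and, for
  \<open>t\<^sub>1, ..., t\<^bsub>L-2\<^esub>\<close>, a parameter \<open>u\<close> in \<open>\<real>\<^bsup>L-2\<^esup>\<close> (extensional functions on \<open>{1..L-2}\<close>).
  A branch is given by logarithms of the linear factors, with \<open>z\<^sup>a = exp (a log z)\<close>.
  A cycle is a twisted chain with vanishing boundary; the boundary plays no role in the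
  definitions below, so they are made for all chains.
\<close>

type_synonym param = "real \<times> (nat \<Rightarrow> real)"

record twisted_cell =
  cell_dom :: "param set"
  cell_base :: "real \<Rightarrow> complex"
  cell_fib :: "param \<Rightarrow> nat \<Rightarrow> complex"
  log_t :: "nat \<Rightarrow> param \<Rightarrow> complex"   \<comment> \<open>branch of \<open>log t\<^sub>l\<close>\<close>
  log_d :: "nat \<Rightarrow> param \<Rightarrow> complex"   \<comment> \<open>branch of \<open>log (t\<^bsub>l-1\<^esub> - t\<^sub>l)\<close>\<close>
  log_x :: "nat \<Rightarrow> param \<Rightarrow> complex"   \<comment> \<open>branch of \<open>log (1 - x\<^sub>i t\<^bsub>L-1\<^esub>)\<close>\<close>

type_synonym twisted_chain = "(complex \<times> twisted_cell) list"

definition fibre_measure :: "nat \<Rightarrow> (nat \<Rightarrow> real) measure" where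
  "fibre_measure L = (\<Pi>\<^sub>M l\<in>{1..L-2}. lborel)"

definition param_measure :: "nat \<Rightarrow> param measure" where
  "param_measure L = lborel \<Otimes>\<^sub>M fibre_measure L"

definition param_top :: "nat \<Rightarrow> param topology" where
  "param_top L =
     prod_topology euclideanreal (product_topology (\<lambda>l. euclideanreal) {1..L-2})"

definition cell_t :: "nat \<Rightarrow> twisted_cell \<Rightarrow> param \<Rightarrow> nat \<Rightarrow> complex" where
  "cell_t L C p l =
     (if l = 0 then 1 else if l = L - 1 then cell_base C (fst p) else cell_fib C p l)"

text \<open>Parameters whose point lies off the branch divisor of \<open>U\<close>.\<close>

definition regular_part ::
  "nat \<Rightarrow> nat \<Rightarrow> (nat \<Rightarrow> complex) \<Rightarrow> twisted_cell \<Rightarrow> param set" where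
  "regular_part L N x C =
     {p \<in> cell_dom C.
        (\<forall>l\<in>{1..L-1}. cell_t L C p l \<noteq> 0 \<and> cell_t L C p (l - 1) \<noteq> cell_t L C p l) \<and>
        (\<forall>i\<in>{1..N}. 1 - x i * cell_t L C p (L - 1) \<noteq> 0)}"

definition fib_partial :: "twisted_cell \<Rightarrow> nat \<Rightarrow> nat \<Rightarrow> param \<Rightarrow> complex" where
  "fib_partial C l j p =
     vector_derivative (\<lambda>w. cell_fib C (fst p, (snd p)(j := w)) l) (at (snd p j))"

text \<open>Cells may touch the branch divisor in a null set only, as the closed simplex does.\<close>

definition is_twisted_cell ::
  "nat \<Rightarrow> nat \<Rightarrow> (nat \<Rightarrow> complex) \<Rightarrow> twisted_cell \<Rightarrow> bool" where
  "is_twisted_cell L N x C \<longleftrightarrow>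
     cell_dom C \<in> sets (param_measure L) \<and>
     (\<exists>V. open V \<and> fst ` cell_dom C \<subseteq> V \<and>
          (\<forall>v\<in>V. cell_base C differentiable at v) \<and>
          continuous_on V (\<lambda>v. vector_derivative (cell_base C) (at v))) \<and>
     (\<exists>W. openin (param_top L) W \<and> cell_dom C \<subseteq> W \<and>
          (\<forall>l\<in>{1..L-2}.
             continuous_map (subtopology (param_top L) W) euclidean (\<lambda>p. cell_fib C p l) \<and>
             (\<forall>j\<in>{1..L-2}.
                (\<forall>p\<in>W. (\<lambda>w. cell_fib C (fst p, (snd p)(j := w)) l)
                          differentiable at (snd p j)) \<and>
                continuous_map (subtopology (param_top L) W) euclidean
                  (fib_partial C l j)))) \<and>
     cell_dom C - regular_part L N x C \<in> null_sets (param_measure L) \<and>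
     (\<forall>l\<in>{1..L-1}.
        continuous_map (subtopology (param_top L) (regular_part L N x C)) euclidean (log_t C l) \<and>
        continuous_map (subtopology (param_top L) (regular_part L N x C)) euclidean (log_d C l) \<and>
        (\<forall>p\<in>regular_part L N x C.
           exp (log_t C l p) = cell_t L C p l \<and>
           exp (log_d C l p) = cell_t L C p (l - 1) - cell_t L C p l)) \<and>
     (\<forall>i\<in>{1..N}.
        continuous_map (subtopology (param_top L) (regular_part L N x C)) euclidean (log_x C i) \<and>
        (\<forall>p\<in>regular_part L N x C. exp (log_x C i p) = 1 - x i * cell_t L C p (L - 1)))"

definition is_twisted_chain ::
  "nat \<Rightarrow> nat \<Rightarrow> (nat \<Rightarrow> complex) \<Rightarrow> twisted_chain \<Rightarrow> bool" where
  "is_twisted_chain L N x c \<longleftrightarrow> (\<forall>(z, C)\<in>set c. is_twisted_cell L N x C)"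

definition pr_chain :: "nat \<Rightarrow> twisted_chain \<Rightarrow> complex set" where
  "pr_chain L c = (\<Union>(z, C)\<in>set c. {cell_t L C p (L - 1) |p. p \<in> cell_dom C})"

definition U_branch ::
  "nat \<Rightarrow> nat \<Rightarrow> (nat \<Rightarrow> complex) \<Rightarrow> (nat \<Rightarrow> complex) \<Rightarrow> (nat \<Rightarrow> complex) \<Rightarrow>
   twisted_cell \<Rightarrow> param \<Rightarrow> complex" where
  "U_branch L N \<alpha> \<gamma> \<beta> C p =
     (\<Prod>l=1..L-1. exp ((\<alpha> l - \<gamma> (l + 1)) * log_t C l p) * exp ((\<gamma> l - \<alpha> l) * log_d C l p)) *
     (\<Prod>i=1..N. exp (- \<beta> i * log_x C i p))"

text \<open>
  The form \<open>U dt\<^sub>1 ... dt\<^bsub>L-2\<^esub> / \<Prod>\<^bsub>l\<noteq>a\<^esub> (t\<^bsub>l-1\<^esub> - t\<^sub>l)\<close> pulled back to the parameters \<open>u\<close>.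
  For \<open>a = 0\<close> no factor is omitted, because \<open>l \<ge> 1\<close>.
\<close>

definition fibre_integrand ::
  "nat \<Rightarrow> nat \<Rightarrow> (nat \<Rightarrow> complex) \<Rightarrow> (nat \<Rightarrow> complex) \<Rightarrow> (nat \<Rightarrow> complex) \<Rightarrow>
   twisted_cell \<Rightarrow> nat \<Rightarrow> param \<Rightarrow> complex" where
  "fibre_integrand L N \<alpha> \<gamma> \<beta> C a p =
     U_branch L N \<alpha> \<gamma> \<beta> C p /
       (\<Prod>l\<in>{1..L-1} - {a}. cell_t L C p (l - 1) - cell_t L C p l) *
     Determinant.det
       (Matrix.mat (L - 2) (L - 2) (\<lambda>(i, j). fib_partial C (Suc i) (Suc j) p))"

definition fibre_integral ::
  "nat \<Rightarrow> nat \<Rightarrow> (nat \<Rightarrow> complex) \<Rightarrow> (nat \<Rightarrow> complex) \<Rightarrow> (nat \<Rightarrow> complex) \<Rightarrow>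
   twisted_cell \<Rightarrow> nat \<Rightarrow> real \<Rightarrow> complex" where
  "fibre_integral L N \<alpha> \<gamma> \<beta> C a v =
     (LINT u:{u. (v, u) \<in> cell_dom C}|fibre_measure L.
        fibre_integrand L N \<alpha> \<gamma> \<beta> C a (v, u))"

text \<open>
  \<open>pr(c)\<close> is parametrised by pairs \<open>(m, v)\<close> of a cell number and a parameter of its base path.
  The complex measure \<open>d\<mu>\<^sub>a\<close> becomes \<open>mu_density\<close> times \<open>base_measure\<close>; the density vanishes
  for \<open>v\<close> outside the projection of the \<open>m\<close>-th cell, where the fibre is empty.
\<close>

definition base_measure :: "twisted_chain \<Rightarrow> (nat \<times> real) measure" where
  "base_measure c = count_space {..<length c} \<Otimes>\<^sub>M lborel"

definition base_point :: "twisted_chain \<Rightarrow> nat \<times> real \<Rightarrow> complex" where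
  "base_point c = (\<lambda>(m, v). cell_base (snd (c ! m)) v)"

definition mu_density ::
  "nat \<Rightarrow> nat \<Rightarrow> (nat \<Rightarrow> complex) \<Rightarrow> (nat \<Rightarrow> complex) \<Rightarrow> (nat \<Rightarrow> complex) \<Rightarrow>
   twisted_chain \<Rightarrow> nat \<Rightarrow> nat \<times> real \<Rightarrow> complex" where
  "mu_density L N \<alpha> \<gamma> \<beta> c a = (\<lambda>(m, v).
     fst (c ! m) * fibre_integral L N \<alpha> \<gamma> \<beta> (snd (c ! m)) a v *
     vector_derivative (cell_base (snd (c ! m))) (at v))"

text \<open>Absolute convergence of the inner integrals (almost everywhere) and of \<open>\<integral> d\<mu>\<^sub>a\<close>.\<close>

definition integrals_converge ::
  "nat \<Rightarrow> nat \<Rightarrow> (nat \<Rightarrow> complex) \<Rightarrow> (nat \<Rightarrow> complex) \<Rightarrow> (nat \<Rightarrow> complex) \<Rightarrow>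
   twisted_chain \<Rightarrow> bool" where
  "integrals_converge L N \<alpha> \<gamma> \<beta> c \<longleftrightarrow>
     (\<forall>a<L.
        (\<forall>(z, C)\<in>set c. AE v in lborel.
           set_integrable (fibre_measure L) {u. (v, u) \<in> cell_dom C}
             (\<lambda>u. fibre_integrand L N \<alpha> \<gamma> \<beta> C a (v, u))) \<and>
        integrable (base_measure c) (mu_density L N \<alpha> \<gamma> \<beta> c a))"

definition moment ::
  "nat \<Rightarrow> nat \<Rightarrow> (nat \<Rightarrow> complex) \<Rightarrow> (nat \<Rightarrow> complex) \<Rightarrow> (nat \<Rightarrow> complex) \<Rightarrow>
   twisted_chain \<Rightarrow> nat \<Rightarrow> int \<Rightarrow> complex" where
  "moment L N \<alpha> \<gamma> \<beta> c a j =
     (if j < 0 then 0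
      else LINT p|base_measure c. base_point c p ^ nat j * mu_density L N \<alpha> \<gamma> \<beta> c a p)"

text \<open>
  \<open>\<integral> F(s) \<Prod>\<^bsub>i\<in>I\<^esub> d\<mu>\<^bsub>\<kappa> i\<^esub>(s\<^sub>i)\<close>, each \<open>s\<^sub>i\<close> running over \<open>pr(c)\<close>.
\<close>

definition mu_integral ::
  "nat \<Rightarrow> nat \<Rightarrow> (nat \<Rightarrow> complex) \<Rightarrow> (nat \<Rightarrow> complex) \<Rightarrow> (nat \<Rightarrow> complex) \<Rightarrow>
   twisted_chain \<Rightarrow> 'i set \<Rightarrow> ('i \<Rightarrow> nat) \<Rightarrow> (('i \<Rightarrow> complex) \<Rightarrow> complex) \<Rightarrow> complex" where
  "mu_integral L N \<alpha> \<gamma> \<beta> c I \<kappa> F =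
     (LINT p|(\<Pi>\<^sub>M i\<in>I. base_measure c).
        F (\<lambda>i. base_point c (p i)) * (\<Prod>i\<in>I. mu_density L N \<alpha> \<gamma> \<beta> c (\<kappa> i) (p i)))"

text \<open>Rows and columns are numbered from 0 here, which does not affect \<open>r - s\<close>.\<close>

definition toeplitz_block :: "(int \<Rightarrow> complex) \<Rightarrow> int \<Rightarrow> nat \<Rightarrow> nat \<Rightarrow> complex mat" where
  "toeplitz_block h j k l = Matrix.mat k l (\<lambda>(r, s). h (j + int r - int s))"

definition Delta ::
  "nat \<Rightarrow> (nat \<Rightarrow> int \<Rightarrow> complex) \<Rightarrow> nat \<Rightarrow> (nat \<Rightarrow> nat) \<Rightarrow> complex" where
  "Delta L h k n =
     (let M = (\<Sum>a<L. n a) in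
      Determinant.det (mat_of_cols M (concat (map
        (\<lambda>a. cols (toeplitz_block (h a) (if a < k then int (n a) else int (n a) - 1) M (n a)))
        [0..<L]))))"

text \<open>The pairs \<open>((a, b), (c, d))\<close> of variable indices with \<open>(a, b) > (c, d)\<close>.\<close>

definition var_indices :: "nat \<Rightarrow> (nat \<Rightarrow> nat) \<Rightarrow> (nat \<times> nat) set" where
  "var_indices L n = (SIGMA a:{..<L}. {1..n a})"

definition decreasing_pairs ::
  "nat \<Rightarrow> (nat \<Rightarrow> nat) \<Rightarrow> ((nat \<times> nat) \<times> (nat \<times> nat)) set" where
  "decreasing_pairs L n =
     {((a, b), (c, d)). (a, b) \<in> var_indices L n \<and> (c, d) \<in> var_indices L n \<and>
                        (a > c \<or> a = c \<and> b > d)}"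

end

theory Submission
  imports Defs
begin

text \<open>
  Expanding the block determinant by the Leibniz formula turns it into the integral of
  \<open>\<Prod>\<^bsub>a<k\<^esub>\<Prod>\<^sub>j s\<^bsub>a,j\<^esub> \<cdot> \<Prod>\<^bsub>a,b\<^esub> s\<^bsub>a,b\<^esub>\<^bsup>n\<^sub>a - b\<^esup>\<close> times the Vandermonde determinant in all the variables.
  The latter is antisymmetric under permutations of the variables within each block, and all
  variables of one block carry the same measure, so the monomial may be antisymmetrised blockwise,
  at the price of \<open>\<Prod>\<^sub>a 1/n\<^sub>a!\<close>; this produces the Vandermonde determinants of the blocks.
  The antisymmetrisation is carried out on the determinant rather than on the integral: both
  Vandermonde factors are expanded into monomials, the product integral factors into moments, and
  a blockwise permutation of the variables becomes a permutation of the columns.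
\<close>

section \<open>Vandermonde determinants over arbitrary index sets\<close>

text \<open>\<open>G i\<close> is the column attached to the index \<open>i\<close>, and
  \<open>e\<close> numbers the indices. Conjugating by \<open>e\<close> identifies the permutations
  of \<open>I\<close> with those of the column numbers and preserves the sign, so the Leibniz sum
  carries over. Any left inverse \<open>g\<close> of \<open>e\<close> on \<open>I\<close> is
  allowed, so that lookup in a list can serve as \<open>g\<close>.\<close>

lemma det_leibniz_reindex:
  fixes G :: "'i \<Rightarrow> nat \<Rightarrow> 'a :: comm_ring_1"
  assumes e: "bij_betw e I {0..<m}" and ge: "\<And>i. i \<in> I \<Longrightarrow> g (e i) = i"
  shows "Determinant.det (Matrix.mat m m (\<lambda>(r, c). G (g c) r)) =
    (\<Sum>\<sigma> | \<sigma> permutes I. of_int (sign \<sigma>) * (\<Prod>i\<in>I. G i (e (\<sigma> i))))"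
proof -
  have img: "e ` I = {0..<m}" using e by (simp add: bij_betw_def)
  have eg: "e (g c) = c \<and> g c \<in> I" if "c \<in> {0..<m}" for c
  proof -
    have "c \<in> e ` I" using that img by simp
    then obtain i where "i \<in> I" "c = e i" by (elim imageE)
    then show ?thesis by (simp add: ge)
  qed
  have g: "bij_betw g {0..<m} I"
    by (rule bij_betw_byWitness[where f' = e]) (auto simp: ge eg img)
  have inj: "inj_on g {0..<m}" using g by (simp add: bij_betw_def)
  let ?A = "Matrix.mat m m (\<lambda>(r, c). G (g c) r)"
  have "Determinant.det ?A =
      (\<Sum>p | p permutes {0..<m}. of_int (sign p) * (\<Prod>c<m. ?A $$ (p c, c)))"
    by (rule det_col) simp
  also have "\<dots> = (\<Sum>\<sigma> | \<sigma> permutes I. of_int (sign \<sigma>) * (\<Prod>i\<in>I. G i (e (\<sigma> i))))"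
  proof (rule sum.reindex_bij_witness[where i = "map_permutation I e" and
        j = "map_permutation {0..<m} g"])
    fix p assume "p \<in> {p. p permutes {0..<m}}"
    then have p: "p permutes {0..<m}" by simp
    show "map_permutation I e (map_permutation {0..<m} g p) = p"
      using eg by (intro map_permutation_compose_inv[OF g p]) auto
    show "map_permutation {0..<m} g p \<in> {\<sigma>. \<sigma> permutes I}"
      using map_permutation_permutes[OF g p] by simp
    have "(\<Prod>i\<in>I. G i (e (map_permutation {0..<m} g p i))) =
        (\<Prod>c\<in>{0..<m}. G (g c) (e (map_permutation {0..<m} g p (g c))))"
      by (rule prod.reindex_bij_betw[OF g, symmetric])
    also have "\<dots> = (\<Prod>c<m. ?A $$ (p c, c))"
      unfolding lessThan_atLeast0
    proof (rule prod.cong[OF refl])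
      fix c assume c: "c \<in> {0..<m}"
      then have "p c \<in> {0..<m}" by (simp only: permutes_in_image[OF p])
      then show "G (g c) (e (map_permutation {0..<m} g p (g c))) = ?A $$ (p c, c)"
        using c eg[of "p c"] by (simp add: map_permutation_apply[OF inj])
    qed
    finally show "of_int (sign (map_permutation {0..<m} g p)) *
        (\<Prod>i\<in>I. G i (e (map_permutation {0..<m} g p i))) =
        of_int (sign p) * (\<Prod>c<m. ?A $$ (p c, c))"
      by (simp add: sign_map_permutation[OF inj p])
  next
    fix \<sigma> assume "\<sigma> \<in> {\<sigma>. \<sigma> permutes I}"
    then have s: "\<sigma> permutes I" by simp
    show "map_permutation {0..<m} g (map_permutation I e \<sigma>) = \<sigma>"
      using ge by (intro map_permutation_compose_inv[OF e s]) auto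
    show "map_permutation I e \<sigma> \<in> {p. p permutes {0..<m}}"
      using map_permutation_permutes[OF e s] by simp
  qed
  finally show ?thesis .
qed

text \<open>Replacing the monomial \<open>x\<^sup>c\<close> by \<open>(x - f 0) \<cdots> (x - f (c - 1))\<close> is a unitriangular
  column operation, and makes the matrix triangular.\<close>

lemma det_vandermonde:
  fixes f :: "nat \<Rightarrow> 'a :: idom"
  shows "Determinant.det (Matrix.mat m m (\<lambda>(r, c). f c ^ r)) = (\<Prod>c<m. \<Prod>d<c. f c - f d)"
proof -
  define P where "P c = (\<Prod>d<c. [:- f d, 1:])" for c
  have deg: "degree (P c) = c" for c
    unfolding P_def by (subst degree_prod_sum_eq) auto
  have lead: "coeff (P c) c = 1" for c
    using lead_coeff_prod[of "\<lambda>d. [:- f d, 1:]" "{..<c}"] deg[of c] by (simp add: P_def)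
  have ev: "poly (P r) (f c) = (\<Prod>d<r. f c - f d)" for r c
    by (simp add: P_def poly_prod)
  define V where "V = Matrix.mat m m (\<lambda>(r, c). f c ^ r)"
  define C where "C = Matrix.mat m m (\<lambda>(r, c). coeff (P r) c)"
  define D where "D = Matrix.mat m m (\<lambda>(r, c). \<Prod>d<r. f c - f d)"
  have carr: "V \<in> carrier_mat m m" "C \<in> carrier_mat m m" "D \<in> carrier_mat m m"
    by (auto simp: V_def C_def D_def)
  \<comment> \<open>Row \<open>r\<close> of \<open>C\<close> holds the coefficients of
    \<open>P r\<close>, so row \<open>r\<close> of the product holds the values of
    \<open>P r\<close> at the nodes. Such a value vanishes at every node \<open>f c\<close> with c <
    r, which makes \<open>D\<close> upper triangular.\<close>
  have "C * V = D"
  proof (rule eq_matI)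
    fix r c assume "r < dim_row D" "c < dim_col D"
    then have rc: "r < m" "c < m" by (auto simp: D_def)
    have "(C * V) $$ (r, c) = (\<Sum>i<m. coeff (P r) i * f c ^ i)"
      using rc by (simp add: C_def V_def scalar_prod_def lessThan_atLeast0)
    also have "\<dots> = (\<Sum>i\<le>r. coeff (P r) i * f c ^ i)"
      using rc deg by (intro sum.mono_neutral_right) (auto simp: coeff_eq_0)
    also have "\<dots> = D $$ (r, c)"
      using rc ev[of r c] deg[of r] by (simp add: D_def poly_altdef)
    finally show "(C * V) $$ (r, c) = D $$ (r, c)" .
  qed (use carr in auto)
  then have "Determinant.det C * Determinant.det V = Determinant.det D"
    using det_mult[OF carr(2,1)] by simp
  moreover have "Determinant.det C = 1"
    using carr(2) lead deg
    by (subst det_lower_triangular[of m]) (auto simp: C_def coeff_eq_0 prod_list_diag_prod)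
  moreover have "Determinant.det D = (\<Prod>c<m. \<Prod>d<c. f c - f d)"
  proof -
    have "upper_triangular D"
      unfolding upper_triangular_def D_def by auto
    then show ?thesis
      by (subst det_upper_triangular[OF _ carr(3)])
         (auto simp: D_def prod_list_diag_prod lessThan_atLeast0)
  qed
  ultimately show ?thesis by (simp add: V_def)
qed

text \<open>The Vandermonde determinant carried over to \<open>I\<close> along the numbering
  \<open>e\<close>, which fixes the orientation of each difference.\<close>

lemma prod_diff_eq_sum_permutations:
  fixes f :: "'i \<Rightarrow> 'a :: idom"
  assumes e: "bij_betw e I {0..<m}"
  shows "(\<Prod>(p, q) \<in> {(p, q). p \<in> I \<and> q \<in> I \<and> e q < e p}. f p - f q) =
    (\<Sum>\<sigma> | \<sigma> permutes I. of_int (sign \<sigma>) * (\<Prod>i\<in>I. f i ^ e (\<sigma> i)))"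
proof -
  define g where "g = inv_into I e"
  have ge: "g (e i) = i" if "i \<in> I" for i
    using e that by (auto simp: g_def bij_betw_def)
  have eg: "e (g c) = c" "g c \<in> I" if "c < m" for c
    using e that by (auto simp: g_def bij_betw_def f_inv_into_f inv_into_into)
  have em: "e i < m" if "i \<in> I" for i
    using e that by (auto simp: bij_betw_def)
  have "(\<Prod>(p, q) \<in> {(p, q). p \<in> I \<and> q \<in> I \<and> e q < e p}. f p - f q) =
      (\<Prod>(c, d) \<in> (SIGMA c:{..<m}. {..<c}). f (g c) - f (g d))"
    by (rule prod.reindex_bij_witness[where i = "\<lambda>(c, d). (g c, g d)" and j = "\<lambda>(p, q). (e p, e q)"])
       (auto simp: ge eg em)
  also have "\<dots> = (\<Prod>c<m. \<Prod>d<c. f (g c) - f (g d))"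
    by (rule prod.Sigma[symmetric]) auto
  also have "\<dots> = Determinant.det (Matrix.mat m m (\<lambda>(r, c). f (g c) ^ r))"
    by (rule det_vandermonde[symmetric])
  also have "\<dots> = (\<Sum>\<sigma> | \<sigma> permutes I. of_int (sign \<sigma>) * (\<Prod>i\<in>I. f i ^ e (\<sigma> i)))"
    by (rule det_leibniz_reindex[OF e ge])
  finally show ?thesis .
qed

text \<open>The differences within a block have the smaller index first, opposite to those in the
  full Vandermonde product. The reversed numbering \<open>n - b\<close> accounts for this, and its
  exponents are the ones found in the columns of a Toeplitz block.\<close>

lemma prod_diff_interval_eq_sum_permutations:
  fixes f :: "nat \<Rightarrow> 'a :: idom"
  shows "(\<Prod>(b, d) \<in> {(b, d). 1 \<le> b \<and> b < d \<and> d \<le> n}. f b - f d) =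
    (\<Sum>\<sigma> | \<sigma> permutes {1..n}. of_int (sign \<sigma>) * (\<Prod>b=1..n. f b ^ (n - \<sigma> b)))"
proof -
  have "bij_betw (\<lambda>b. n - b) {1..n} {0..<n}"
    by (rule bij_betw_byWitness[where f' = "\<lambda>b. n - b"]) auto
  moreover have "{(b, d). 1 \<le> b \<and> b < d \<and> d \<le> n} =
      {(p, q). p \<in> {1..n} \<and> q \<in> {1..n} \<and> n - q < n - p}"
    by auto
  ultimately show ?thesis
    using prod_diff_eq_sum_permutations[of "\<lambda>b. n - b" "{1..n}" n f] by simp
qed

section \<open>Blockwise permutations of the variables\<close>

text \<open>The families \<open>T\<close> used later are extensional and arbitrary beyond
  \<open>L\<close>; the test \<open>a < L\<close> makes the map the identity there, as a permutation
  of the variables requires.\<close>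

definition blockwise :: "nat \<Rightarrow> (nat \<Rightarrow> nat \<Rightarrow> nat) \<Rightarrow> nat \<times> nat \<Rightarrow> nat \<times> nat" where
  "blockwise L T = (\<lambda>(a, b). (a, if a < L then T a b else b))"

lemma finite_var_indices [simp]: "finite (var_indices L n)"
  by (simp add: var_indices_def)

lemma var_indices_Suc: "var_indices (Suc L) n = var_indices L n \<union> Pair L ` {1..n L}"
  by (auto simp: var_indices_def less_Suc_eq)

text \<open>Induction on the number of blocks: a further block composes the map with a copy
  \<open>p\<close> of \<open>T L\<close> on that block, and the sign is multiplicative.\<close>

lemma blockwise_permutes_sign:
  assumes "\<And>a. a < L \<Longrightarrow> T a permutes {1..n a}"
  shows "blockwise L T permutes var_indices L n \<and> sign (blockwise L T) = (\<Prod>a<L. sign (T a))"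
  using assms
proof (induction L)
  case 0
  have "blockwise 0 T = id" by (auto simp: blockwise_def)
  then show ?case by (simp only: permutes_id sign_id lessThan_0 prod.empty simp_thms)
next
  case (Suc L)
  define p where "p = map_permutation {1..n L} (Pair L) (T L)"
  have T: "T L permutes {1..n L}" using Suc.prems by simp
  have inj: "inj_on (Pair L) {1..n L}" by (simp add: inj_on_def)
  have p: "p permutes Pair L ` {1..n L}"
    unfolding p_def by (rule map_permutation_permutes[OF _ T]) (use inj in \<open>simp add: bij_betw_def\<close>)
  have sp: "sign p = sign (T L)"
    unfolding p_def by (rule sign_map_permutation[OF inj T]) simp
  have IH: "blockwise L T permutes var_indices L n" "sign (blockwise L T) = (\<Prod>a<L. sign (T a))"
    using Suc by auto
  \<comment> \<open>\<open>blockwise L T\<close> fixes block \<open>L\<close> pointwise and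
    \<open>p\<close> fixes all other blocks, so each block feels its own permutation only.\<close>
  have eq: "blockwise (Suc L) T = p \<circ> blockwise L T"
  proof (rule ext, clarify)
    fix a b
    show "blockwise (Suc L) T (a, b) = (p \<circ> blockwise L T) (a, b)"
    proof (cases "a = L \<and> b \<in> {1..n L}")
      case True
      then show ?thesis
        using map_permutation_apply[OF inj, of b "T L"] by (simp add: blockwise_def p_def)
    next
      case False
      then have "p (a, b') = (a, b')" if "a \<noteq> L \<or> b' = b" for b'
        using that by (intro permutes_not_in[OF p]) auto
      moreover have "T L b = b" if "a = L"
        using False that by (intro permutes_not_in[OF T]) auto
      ultimately show ?thesis by (cases "a = L") (auto simp: blockwise_def)
    qed
  qed
  have "p permutes var_indices (Suc L) n" "blockwise L T permutes var_indices (Suc L) n"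
    by (auto simp: var_indices_Suc intro: permutes_subset[OF p] permutes_subset[OF IH(1)])
  note perm = this
  have "sign (p \<circ> blockwise L T) = sign p * sign (blockwise L T)"
    by (intro sign_compose perm[THEN permutes_imp_permutation[OF finite_var_indices]])
  then show ?case
    unfolding eq using permutes_compose[OF perm(2,1)] by (simp only: IH sp prod.lessThan_Suc mult_ac simp_thms)
qed


lemma card_var_indices: "card (var_indices L n) = (\<Sum>a<L. n a)"
  by (simp add: var_indices_def)

text \<open>A blockwise permutation of the columns of a determinant changes its sign by
  \<open>\<Prod>\<^sub>a sign (T a)\<close>, which cancels the sign in front of it.\<close>

lemma sum_blockwise_permutations:
  fixes L :: nat and n :: "nat \<Rightarrow> nat"
    and G :: "nat \<times> nat \<Rightarrow> nat \<Rightarrow> 'a :: {comm_ring_1, ring_char_0}"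
  defines "I \<equiv> var_indices L n"
  shows "(\<Sum>T \<in> (\<Pi>\<^sub>E a\<in>{..<L}. {\<tau>. \<tau> permutes {1..n a}}). \<Sum>\<sigma> | \<sigma> permutes I.
      of_int (\<Prod>a<L. sign (T a)) *
        (of_int (sign \<sigma>) * (\<Prod>i\<in>I. G (blockwise L T i) (e (\<sigma> i))))) =
    (\<Prod>a<L. fact (n a)) * (\<Sum>\<sigma> | \<sigma> permutes I. of_int (sign \<sigma>) * (\<Prod>i\<in>I. G i (e (\<sigma> i))))"
    (is "?l = _ * ?D")
proof -
  have "(\<Sum>\<sigma> | \<sigma> permutes I. of_int (\<Prod>a<L. sign (T a)) *
      (of_int (sign \<sigma>) * (\<Prod>i\<in>I. G (blockwise L T i) (e (\<sigma> i))))) = ?D"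
    if "T \<in> (\<Pi>\<^sub>E a\<in>{..<L}. {\<tau>. \<tau> permutes {1..n a}})" for T
  proof -
    let ?B = "blockwise L T"
    have T: "T a permutes {1..n a}" if "a < L" for a
      using \<open>T \<in> _\<close> that by (auto simp: PiE_iff)
    have B: "?B permutes I" "sign ?B = (\<Prod>a<L. sign (T a))"
      using blockwise_permutes_sign[OF T] by (auto simp: I_def)
    have "(\<Sum>\<sigma> | \<sigma> permutes I. of_int (\<Prod>a<L. sign (T a)) *
        (of_int (sign \<sigma>) * (\<Prod>i\<in>I. G (?B i) (e (\<sigma> i))))) =
        (\<Sum>\<sigma> | \<sigma> permutes I. of_int (sign ?B) *
        (of_int (sign (\<sigma> \<circ> ?B)) * (\<Prod>i\<in>I. G (?B i) (e ((\<sigma> \<circ> ?B) i)))))"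
      \<comment> \<open>Right translation by \<open>?B\<close> permutes the summands; afterwards
        \<open>?B\<close> occurs in both arguments of \<open>G\<close> and can be removed by
        reindexing the product.\<close>
      unfolding B(2)[symmetric] by (rule sum_permutations_compose_right[OF B(1)])
    also have "\<dots> = ?D"
    proof (rule sum.cong[OF refl])
      fix \<sigma> assume "\<sigma> \<in> {\<sigma>. \<sigma> permutes I}"
      then have s: "\<sigma> permutes I" by simp
      have "sign (\<sigma> \<circ> ?B) = sign \<sigma> * sign ?B"
        using s B(1) by (intro sign_compose permutes_imp_permutation[of I]) (auto simp: I_def)
      \<comment> \<open>The sign of \<open>?B\<close> now occurs twice, and its square is 1.\<close>
      then have "of_int (sign ?B) * (of_int (sign (\<sigma> \<circ> ?B)) * y) = of_int (sign \<sigma>) * y"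
        for y :: 'a
        by (cases "?B" rule: sign_cases) auto
      moreover have "(\<Prod>i\<in>I. G (?B i) (e ((\<sigma> \<circ> ?B) i))) = (\<Prod>i\<in>I. G i (e (\<sigma> i)))"
        using prod.permute[OF B(1), of "\<lambda>i. G i (e (\<sigma> i))"] by (simp add: o_def)
      ultimately show "of_int (sign ?B) * (of_int (sign (\<sigma> \<circ> ?B)) *
          (\<Prod>i\<in>I. G (?B i) (e ((\<sigma> \<circ> ?B) i)))) = of_int (sign \<sigma>) * (\<Prod>i\<in>I. G i (e (\<sigma> i)))"
        by simp
    qed
    finally show ?thesis .
  qed
  then have "?l = (\<Sum>T \<in> (\<Pi>\<^sub>E a\<in>{..<L}. {\<tau>. \<tau> permutes {1..n a}}). ?D)"
    by (rule sum.cong[OF refl])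
  also have "\<dots> = of_nat (card (\<Pi>\<^sub>E a\<in>{..<L}. {\<tau>. \<tau> permutes {1..n a}})) * ?D"
    by (rule sum_constant)
  also have "card (\<Pi>\<^sub>E a\<in>{..<L}. {\<tau>. \<tau> permutes {1..n a}}) = (\<Prod>a<L. fact (n a))"
    by (simp add: card_PiE card_permutations)
  finally show ?thesis by (simp add: of_nat_prod)
qed

section \<open>Lexicographic numbering of the variables and the columns of the block
  determinant\<close>

definition offset :: "(nat \<Rightarrow> nat) \<Rightarrow> nat \<times> nat \<Rightarrow> nat" where
  "offset n = (\<lambda>(a, b). (\<Sum>i<a. n i) + b - 1)"

lemma offset_less_iff:
  assumes "(a, b) \<in> var_indices L n" "(c, d) \<in> var_indices L n"
  shows "offset n (c, d) < offset n (a, b) \<longleftrightarrow> a > c \<or> a = c \<and> b > d"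
proof -
  \<comment> \<open>Block \<open>i\<close> ends no later than block \<open>j\<close> begins.\<close>
  have *: "sum n {..<i} + n i \<le> sum n {..<j}" if "i < j" for i j
    using sum_mono2[of "{..<j}" "{..<Suc i}" n] that by (auto simp: add.commute)
  show ?thesis
    using assms *[of a c] *[of c a]
    by (cases a c rule: linorder_cases) (auto simp: offset_def var_indices_def)
qed

lemma bij_betw_offset:
  "bij_betw (offset n) (var_indices L n) {0..<\<Sum>a<L. n a}"
proof -
  have inj: "inj_on (offset n) (var_indices L n)"
  proof (rule inj_onI, clarify)
    fix a b c d
    assume "(a, b) \<in> var_indices L n" "(c, d) \<in> var_indices L n" "offset n (a, b) = offset n (c, d)"
    then show "a = c \<and> b = d"
      using offset_less_iff[of a b L n c d] offset_less_iff[of c d L n a b] by auto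
  qed
  have "offset n ` var_indices L n \<subseteq> {0..<\<Sum>a<L. n a}"
  proof clarify
    fix a b assume ab: "(a, b) \<in> var_indices L n"
    have "sum n {..<Suc a} \<le> sum n {..<L}"
      using ab by (intro sum_mono2) (auto simp: var_indices_def)
    then show "offset n (a, b) \<in> {0..<\<Sum>a<L. n a}"
      using ab by (auto simp: offset_def var_indices_def)
  qed
  \<comment> \<open>Surjectivity follows by counting, as both sets have the same finite
    cardinality.\<close>
  then have "offset n ` var_indices L n = {0..<\<Sum>a<L. n a}"
    by (rule card_subset_eq[rotated]) (simp_all add: card_image[OF inj] card_var_indices)
  then show ?thesis using inj by (simp add: bij_betw_def)
qed

text \<open>The inverse of \<open>offset\<close> as a list, built by the same concatenation over
  blocks as the columns in \<open>Delta\<close>.\<close>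

definition var_list :: "nat \<Rightarrow> (nat \<Rightarrow> nat) \<Rightarrow> (nat \<times> nat) list" where
  "var_list L n = concat (map (\<lambda>a. map (Pair a) [1..<Suc (n a)]) [0..<L])"

lemma length_var_list: "length (var_list L n) = (\<Sum>a<L. n a)"
  by (induction L) (auto simp: var_list_def)

lemma nth_var_list: "p \<in> var_indices L n \<Longrightarrow> var_list L n ! offset n p = p"
proof (induction L)
  case 0
  then show ?case by (simp add: var_indices_def)
next
  case (Suc L)
  have app: "var_list (Suc L) n = var_list L n @ map (Pair L) [1..<Suc (n L)]"
    by (simp add: var_list_def)
  show ?case
  proof (cases "p \<in> var_indices L n")
    case True
    then have "offset n p < length (var_list L n)"
      using bij_betw_offset[of n L] by (auto simp: bij_betw_def length_var_list)
    then show ?thesis using Suc True by (simp add: app nth_append)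
  next
    case False
    then obtain b where b: "p = (L, b)" "1 \<le> b" "b \<le> n L"
      using Suc.prems by (auto simp: var_indices_Suc)
    then show ?thesis
      by (auto simp: app nth_append length_var_list offset_def simp del: upt_Suc)
  qed
qed

text \<open>With rows and columns counted from 0, column (a, b) sits at place b - 1 of its block, so
  its entry in row r has index n_a - 1 + r - (b - 1) = n_a - b + r, and one more if a < k. Since b
  \<le> n_a, the index is a natural number and truncated subtraction is exact.\<close>

lemma Delta_eq_sum_permutations:
  "Delta L h k n = (\<Sum>\<sigma> | \<sigma> permutes var_indices L n. of_int (sign \<sigma>) *
     (\<Prod>(a, b)\<in>var_indices L n.
        h a (int ((if a < k then 1 else 0) + (n a - b) + offset n (\<sigma> (a, b))))))"
proof -
  define M where "M = (\<Sum>a<L. n a)"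
  define G where "G = (\<lambda>(a, b) r. h a (int ((if a < k then 1 else 0) + (n a - b) + r)))"
  have "cols (toeplitz_block (h a) (if a < k then int (n a) else int (n a) - 1) M (n a)) =
      map (\<lambda>b. Matrix.vec M (G (a, b))) [1..<Suc (n a)]" for a
    by (rule nth_equalityI)
       (auto simp: toeplitz_block_def G_def of_nat_diff Suc_le_eq algebra_simps
          intro!: arg_cong[of _ _ "h a"] simp del: upt_Suc)
  then have "Delta L h k n = Determinant.det (mat_of_cols M
      (map (\<lambda>i. Matrix.vec M (G i)) (var_list L n)))"
    unfolding Delta_def Let_def M_def[symmetric] var_list_def by (simp add: map_concat o_def)
  also have "mat_of_cols M (map (\<lambda>i. Matrix.vec M (G i)) (var_list L n)) =
      Matrix.mat M M (\<lambda>(r, c). G (var_list L n ! c) r)"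
    by (rule eq_matI) (auto simp: mat_of_cols_def length_var_list M_def)
  also have "Determinant.det \<dots> = (\<Sum>\<sigma> | \<sigma> permutes var_indices L n. of_int (sign \<sigma>) *
      (\<Prod>i\<in>var_indices L n. G i (offset n (\<sigma> i))))"
    unfolding M_def by (rule det_leibniz_reindex[OF bij_betw_offset nth_var_list])
  finally show ?thesis by (simp add: G_def case_prod_unfold)
qed


section \<open>Monomial expansion of the integrand\<close>

lemma decreasing_pairs_eq_offset:
  "decreasing_pairs L n =
    {(p, q). p \<in> var_indices L n \<and> q \<in> var_indices L n \<and> offset n q < offset n p}"
  by (auto simp: decreasing_pairs_def offset_less_iff)

text \<open>Multiplying out the Vandermonde sums of all blocks amounts to choosing one permutation
  per block, that is, a family \<open>T\<close>.\<close>

lemma prod_within_blocks_eq_sum: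
  fixes s :: "nat \<times> nat \<Rightarrow> 'a :: idom"
  shows "(\<Prod>a<L. \<Prod>(b, d) \<in> {(b, d). 1 \<le> b \<and> b < d \<and> d \<le> n a}. s (a, b) - s (a, d)) =
    (\<Sum>T \<in> (\<Pi>\<^sub>E a\<in>{..<L}. {\<tau>. \<tau> permutes {1..n a}}). of_int (\<Prod>a<L. sign (T a)) *
      (\<Prod>(a, b)\<in>var_indices L n. s (a, b) ^ (n a - T a b)))"
proof -
  have "(\<Prod>a<L. \<Prod>(b, d) \<in> {(b, d). 1 \<le> b \<and> b < d \<and> d \<le> n a}. s (a, b) - s (a, d)) =
      (\<Prod>a<L. \<Sum>\<tau> | \<tau> permutes {1..n a}.
        of_int (sign \<tau>) * (\<Prod>b=1..n a. s (a, b) ^ (n a - \<tau> b)))"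
    by (intro prod.cong refl prod_diff_interval_eq_sum_permutations)
  also have "\<dots> = (\<Sum>T \<in> (\<Pi>\<^sub>E a\<in>{..<L}. {\<tau>. \<tau> permutes {1..n a}}). \<Prod>a<L.
        of_int (sign (T a)) * (\<Prod>b=1..n a. s (a, b) ^ (n a - T a b)))"
    by (intro prod_sum_PiE finite_lessThan finite_permutations finite_atLeastAtMost)
  also have "\<dots> = (\<Sum>T \<in> (\<Pi>\<^sub>E a\<in>{..<L}. {\<tau>. \<tau> permutes {1..n a}}).
      of_int (\<Prod>a<L. sign (T a)) * (\<Prod>(a, b)\<in>var_indices L n. s (a, b) ^ (n a - T a b)))"
    by (intro sum.cong refl) (simp add: prod.distrib var_indices_def prod.Sigma)
  finally show ?thesis .
qed

text \<open>The three summands of the exponent come from the monomial prefactor, the Vandermonde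
  products of the blocks and the full Vandermonde product, in this order.\<close>

lemma integrand_eq_sum:
  fixes s :: "nat \<times> nat \<Rightarrow> 'a :: idom"
  assumes "k \<le> L"
  shows "(\<Prod>a<k. \<Prod>j=1..n a. s (a, j)) * (\<Prod>(p, q)\<in>decreasing_pairs L n. s p - s q) *
      (\<Prod>a<L. \<Prod>(b, d) \<in> {(b, d). 1 \<le> b \<and> b < d \<and> d \<le> n a}. s (a, b) - s (a, d)) =
    (\<Sum>T \<in> (\<Pi>\<^sub>E a\<in>{..<L}. {\<tau>. \<tau> permutes {1..n a}}). \<Sum>\<sigma> | \<sigma> permutes var_indices L n.
      of_int (\<Prod>a<L. sign (T a)) * (of_int (sign \<sigma>) * (\<Prod>(a, b)\<in>var_indices L n.
        s (a, b) ^ ((if a < k then 1 else 0) + (n a - T a b) + offset n (\<sigma> (a, b))))))"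
proof -
  let ?I = "var_indices L n"
  have 1: "(\<Prod>a<k. \<Prod>j=1..n a. s (a, j)) = (\<Prod>(a, b)\<in>?I. s (a, b) ^ (if a < k then 1 else 0))"
  proof -
    have "(\<Prod>(a, b)\<in>?I. s (a, b) ^ (if a < k then 1 else 0)) =
        (\<Prod>a<L. \<Prod>j=1..n a. s (a, j) ^ (if a < k then 1 else 0))"
      unfolding var_indices_def by (rule prod.Sigma[symmetric]) auto
    also have "\<dots> = (\<Prod>a<k. \<Prod>j=1..n a. s (a, j) ^ (if a < k then 1 else 0))"
      using assms by (intro prod.mono_neutral_right) auto
    also have "\<dots> = (\<Prod>a<k. \<Prod>j=1..n a. s (a, j))"
      by (intro prod.cong) auto
    finally show ?thesis by simp
  qed
  have 2: "(\<Prod>(p, q)\<in>decreasing_pairs L n. s p - s q) =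
      (\<Sum>\<sigma> | \<sigma> permutes ?I. of_int (sign \<sigma>) * (\<Prod>i\<in>?I. s i ^ offset n (\<sigma> i)))"
    unfolding decreasing_pairs_eq_offset by (rule prod_diff_eq_sum_permutations[OF bij_betw_offset])
  show ?thesis
    unfolding 1 2 prod_within_blocks_eq_sum sum_distrib_left sum_distrib_right
    by (intro sum.cong refl)
       (simp add: power_add prod.distrib case_prod_unfold mult_ac)
qed

section \<open>Integration\<close>

text \<open>The analytic content in abstract form: \<open>z\<close> is the integration variable and
  \<open>\<rho> a\<close> the density of the a-th complex measure relative to a common sigma-finite
  measure \<open>B\<close>.\<close>

lemma integral_antisymmetrized_eq_Delta:
  fixes L k :: nat and n :: "nat \<Rightarrow> nat" and z :: "'p \<Rightarrow> complex" and \<rho> :: "nat \<Rightarrow> 'p \<Rightarrow> complex" and m :: "nat \<Rightarrow> int \<Rightarrow> complex"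
  assumes "k \<le> L" and B: "sigma_finite_measure B"
    and int: "\<And>a j. a < L \<Longrightarrow> integrable B (\<lambda>p. z p ^ j * \<rho> a p)"
    and m: "\<And>a j. a < L \<Longrightarrow> m a (int j) = (LINT p|B. z p ^ j * \<rho> a p)"
  defines "I \<equiv> var_indices L n"
  defines "F \<equiv> (\<lambda>s. (\<Prod>a<k. \<Prod>j=1..n a. s (a, j)) *
      (\<Prod>(p, q)\<in>decreasing_pairs L n. s p - s q) *
      (\<Prod>a<L. \<Prod>(b, d) \<in> {(b, d). 1 \<le> b \<and> b < d \<and> d \<le> n a}. s (a, b) - s (a, d)) :: complex)"
  shows "(LINT p|(\<Pi>\<^sub>M i\<in>I. B). F (\<lambda>i. z (p i)) * (\<Prod>i\<in>I. \<rho> (fst i) (p i))) =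
    (\<Prod>a<L. fact (n a)) * Delta L m k n"
proof -
  interpret product_sigma_finite "\<lambda>_ :: nat \<times> nat. B"
    using B by (simp add: product_sigma_finite_def)
  define \<TT> where "\<TT> = (\<Pi>\<^sub>E a\<in>{..<L}. {\<tau>. \<tau> permutes {1..n a}})"
  define \<SS> where "\<SS> = {\<sigma>. \<sigma> permutes I}"
  define ex where "ex T \<sigma> i = (if fst i < k then 1 else 0) +
      (n (fst i) - T (fst i) (snd i)) + offset n (\<sigma> i)" for T \<sigma> and i :: "nat \<times> nat"
  define f where "f T \<sigma> = (\<lambda>i p. z p ^ ex T \<sigma> i * \<rho> (fst i) p)" for T \<sigma>
  have fin: "finite I" by (simp add: I_def)
  have I: "fst i < L" if "i \<in> I" for i
    using that by (auto simp: I_def var_indices_def)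
  have f_int: "integrable B (f T \<sigma> i)" if "i \<in> I" for T \<sigma> i
    unfolding f_def using int I that by simp
  \<comment> \<open>Each factor depends on one variable only, so Fubini splits the integral into
    moments.\<close>
  have prod_int: "(LINT p|(\<Pi>\<^sub>M i\<in>I. B). (\<Prod>i\<in>I. f T \<sigma> i (p i))) =
      (\<Prod>i\<in>I. m (fst i) (int (ex T \<sigma> i)))" for T \<sigma>
    by (subst product_integral_prod[OF fin, of "f T \<sigma>", OF f_int]) (auto simp: m I f_def intro: prod.cong)
  have "F (\<lambda>i. z (p i)) * (\<Prod>i\<in>I. \<rho> (fst i) (p i)) =
      (\<Sum>T\<in>\<TT>. \<Sum>\<sigma>\<in>\<SS>. of_int (\<Prod>a<L. sign (T a)) * (of_int (sign \<sigma>) * (\<Prod>i\<in>I. f T \<sigma> i (p i))))"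
    for p
    unfolding F_def integrand_eq_sum[OF assms(1)] sum_distrib_right \<TT>_def \<SS>_def I_def f_def ex_def
    by (simp add: prod.distrib case_prod_unfold mult.assoc)
  then have "(LINT p|(\<Pi>\<^sub>M i\<in>I. B). F (\<lambda>i. z (p i)) * (\<Prod>i\<in>I. \<rho> (fst i) (p i))) =
      (LINT p|(\<Pi>\<^sub>M i\<in>I. B). (\<Sum>T\<in>\<TT>. \<Sum>\<sigma>\<in>\<SS>.
        of_int (\<Prod>a<L. sign (T a)) * (of_int (sign \<sigma>) * (\<Prod>i\<in>I. f T \<sigma> i (p i)))))"
    by simp
  also have "\<dots> = (\<Sum>T\<in>\<TT>. \<Sum>\<sigma>\<in>\<SS>. of_int (\<Prod>a<L. sign (T a)) *
      (of_int (sign \<sigma>) * (LINT p|(\<Pi>\<^sub>M i\<in>I. B). (\<Prod>i\<in>I. f T \<sigma> i (p i)))))"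
    using product_integrable_prod[OF fin, of "f _ _", OF f_int] by simp
  also have "\<dots> = (\<Sum>T\<in>\<TT>. \<Sum>\<sigma>\<in>\<SS>. of_int (\<Prod>a<L. sign (T a)) *
      (of_int (sign \<sigma>) * (\<Prod>i\<in>I. m (fst i) (int (ex T \<sigma> i)))))"
    by (simp only: prod_int)
  \<comment> \<open>The moment of variable (a, b) depends on b only through T a b. Hence
    \<open>T\<close> may act on the index instead of the exponent, and a term becomes a Leibniz term
    of \<open>Delta\<close> with permuted columns.\<close>
  also have "\<dots> = (\<Sum>T\<in>\<TT>. \<Sum>\<sigma>\<in>\<SS>. of_int (\<Prod>a<L. sign (T a)) * (of_int (sign \<sigma>) *
      (\<Prod>i\<in>I. (\<lambda>(a, b) r. m a (int ((if a < k then 1 else 0) + (n a - b) + r)))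
        (blockwise L T i) (offset n (\<sigma> i)))))"
    using I by (intro sum.cong refl arg_cong2[of _ _ _ _ "(*)"] prod.cong)
      (auto simp: ex_def blockwise_def case_prod_unfold)
  also have "\<dots> = (\<Prod>a<L. fact (n a)) * (\<Sum>\<sigma>\<in>\<SS>. of_int (sign \<sigma>) *
      (\<Prod>i\<in>I. (\<lambda>(a, b) r. m a (int ((if a < k then 1 else 0) + (n a - b) + r)))
        i (offset n (\<sigma> i))))"
    unfolding \<TT>_def \<SS>_def I_def by (rule sum_blockwise_permutations)
  also have "\<dots> = (\<Prod>a<L. fact (n a)) * Delta L m k n"
    by (simp add: Delta_eq_sum_permutations \<SS>_def I_def case_prod_unfold)
  finally show ?thesis .
qed

section \<open>Convergence of the moment integrals\<close>

lemma mu_density_eq_0: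
  assumes "v \<notin> fst ` cell_dom (snd (c ! i))"
  shows "mu_density L N \<alpha> \<gamma> \<beta> c a (i, v) = 0"
proof -
  have "{u. (v, u) \<in> cell_dom (snd (c ! i))} = {}" using assms by force
  then show ?thesis by (simp add: mu_density_def fibre_integral_def set_lebesgue_integral_def)
qed

lemma base_point_in_pr_chain:
  assumes "L \<ge> 2" "i < length c" "v \<in> fst ` cell_dom (snd (c ! i))"
  shows "base_point c (i, v) \<in> pr_chain L c"
proof -
  obtain u where u: "(v, u) \<in> cell_dom (snd (c ! i))" using assms(3) by auto
  have "base_point c (i, v) = cell_t L (snd (c ! i)) (v, u) (L - 1)"
    using assms(1) by (simp add: base_point_def cell_t_def)
  moreover have "(fst (c ! i), snd (c ! i)) \<in> set c"
    using assms(2) by simp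
  ultimately show ?thesis unfolding pr_chain_def using u by blast
qed

text \<open>Only where the density is nonzero is the base path known to be continuous, or bounded.\<close>

lemma integrable_moment:
  assumes "L \<ge> 2" and chain: "is_twisted_chain L N x c" and "bounded (pr_chain L c)"
    and int: "integrable (base_measure c) (mu_density L N \<alpha> \<gamma> \<beta> c a)"
  shows "integrable (base_measure c) (\<lambda>p. base_point c p ^ j * mu_density L N \<alpha> \<gamma> \<beta> c a p)"
proof -
  let ?\<rho> = "mu_density L N \<alpha> \<gamma> \<beta> c a"
  obtain K where K: "\<And>y. y \<in> pr_chain L c \<Longrightarrow> norm y \<le> K"
    using assms(3) by (auto simp: bounded_iff)
  have "\<exists>V. open V \<and> fst ` cell_dom (snd (c ! i)) \<subseteq> V \<and> continuous_on V (cell_base (snd (c ! i)))"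
    if "i < length c" for i
  proof -
    have "(fst (c ! i), snd (c ! i)) \<in> set c" using that by simp
    then have "is_twisted_cell L N x (snd (c ! i))"
      using chain unfolding is_twisted_chain_def by blast
    then obtain V where "open V" "fst ` cell_dom (snd (c ! i)) \<subseteq> V"
        "\<forall>v\<in>V. cell_base (snd (c ! i)) differentiable at v"
      unfolding is_twisted_cell_def by blast
    then show ?thesis
      by (metis continuous_at_imp_continuous_on differentiable_imp_continuous_within)
  qed
  then obtain V where V: "\<And>i. i < length c \<Longrightarrow> open (V i)"
      "\<And>i. i < length c \<Longrightarrow> fst ` cell_dom (snd (c ! i)) \<subseteq> V i"
      "\<And>i. i < length c \<Longrightarrow> continuous_on (V i) (cell_base (snd (c ! i)))"
    by metis
  \<comment> \<open>Extending the base path by 0 outside an open set on which it is continuous gives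
    a measurable function.\<close>
  define b where "b = (\<lambda>(i, v). indicator (V i) v *\<^sub>R cell_base (snd (c ! i)) v)"
  have b_meas: "b \<in> borel_measurable (base_measure c)"
    unfolding base_measure_def
  proof (rule measurable_pair_measure_countable1)
    show "countable {..<length c}" by simp
    fix i assume "i \<in> {..<length c}"
    then show "(\<lambda>v. b (i, v)) \<in> borel_measurable lborel"
      using borel_measurable_continuous_on_indicator[OF _ V(3)[of i]] V(1)[of i]
      by (simp add: b_def)
  qed
  \<comment> \<open>Either the density vanishes, or the parameter lies in the projection of its
    cell; there \<open>b\<close> is the base point, which lies in \<open>pr_chain L c\<close> and is
    bounded by \<open>K\<close>.\<close>
  have eq: "base_point c p ^ j * ?\<rho> p = b p ^ j * ?\<rho> p" and
    bound: "norm (base_point c p ^ j * ?\<rho> p) \<le> norm (K ^ j * ?\<rho> p)"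
    if "p \<in> space (base_measure c)" for p
  proof -
    obtain i v where p: "p = (i, v)" by (cases p)
    have i: "i < length c" using that by (simp add: p base_measure_def space_pair_measure)
    consider "?\<rho> p = 0" | "v \<in> fst ` cell_dom (snd (c ! i))"
      using mu_density_eq_0[of v c i] p by blast
    then have "base_point c p ^ j * ?\<rho> p = b p ^ j * ?\<rho> p \<and>
      norm (base_point c p ^ j * ?\<rho> p) \<le> norm (K ^ j * ?\<rho> p)"
    proof cases
      case 1
      then show ?thesis by simp
    next
      case 2
      then have "v \<in> V i" using V(2)[OF i] by blast
      then have "b p = base_point c p" by (simp add: p b_def base_point_def)
      moreover have "norm (base_point c p) \<le> K"
        using K base_point_in_pr_chain[OF assms(1) i 2] by (simp add: p)
      then have "norm (base_point c p) ^ j \<le> \<bar>K\<bar> ^ j"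
        by (intro power_mono) auto
      ultimately show ?thesis
        by (simp add: norm_mult norm_power mult_right_mono)
    qed
    then show "base_point c p ^ j * ?\<rho> p = b p ^ j * ?\<rho> p"
      "norm (base_point c p ^ j * ?\<rho> p) \<le> norm (K ^ j * ?\<rho> p)" by auto
  qed
  show ?thesis
  proof (rule Bochner_Integration.integrable_bound)
    show "integrable (base_measure c) (\<lambda>p. K ^ j * ?\<rho> p)"
      using int by simp
    have "(\<lambda>p. b p ^ j * ?\<rho> p) \<in> borel_measurable (base_measure c)"
      using b_meas int by (intro borel_measurable_times borel_measurable_power) auto
    then show "(\<lambda>p. base_point c p ^ j * ?\<rho> p) \<in> borel_measurable (base_measure c)"
      by (subst measurable_cong[OF eq])
    show "AE p in base_measure c. norm (base_point c p ^ j * ?\<rho> p) \<le> norm (K ^ j * ?\<rho> p)"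
      by (rule AE_I2) (rule bound)
  qed
qed

lemma sigma_finite_base_measure: "sigma_finite_measure (base_measure c)"
  unfolding base_measure_def
  by (intro sigma_finite_pair_measure sigma_finite_measure_count_space_countable
      lborel.sigma_finite_measure_axioms) auto

theorem mainTheorem4:
  fixes L N k :: nat
    and \<alpha> \<gamma> \<beta> x :: "nat \<Rightarrow> complex"
    and c :: twisted_chain
    and n :: "nat \<Rightarrow> nat"
  assumes "L \<ge> 2"
    and "k \<le> L"
    and "\<gamma> L = 1"
    and "is_twisted_chain L N x c"
    and "bounded (pr_chain L c)"
    and "integrals_converge L N \<alpha> \<gamma> \<beta> c"
  shows "Delta L (moment L N \<alpha> \<gamma> \<beta> c) k n =
     (\<Prod>a<L. 1 / fact (n a)) *
     mu_integral L N \<alpha> \<gamma> \<beta> c (var_indices L n) fst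
       (\<lambda>s. (\<Prod>a<k. \<Prod>j=1..n a. s (a, j)) *
            (\<Prod>(p, q)\<in>decreasing_pairs L n. s p - s q) *
            (\<Prod>a<L. \<Prod>(b, d)\<in>{(b, d). 1 \<le> b \<and> b < d \<and> d \<le> n a}. s (a, b) - s (a, d)))"
proof -
  let ?m = "moment L N \<alpha> \<gamma> \<beta> c"
  have "integrable (base_measure c) (\<lambda>p. base_point c p ^ j * mu_density L N \<alpha> \<gamma> \<beta> c a p)"
    if "a < L" for a j
    using integrable_moment[OF assms(1,4,5)] assms(6) that by (auto simp: integrals_converge_def)
  moreover have "?m a (int j) =
      (LINT p|base_measure c. base_point c p ^ j * mu_density L N \<alpha> \<gamma> \<beta> c a p)" for a j
    by (simp add: moment_def)
  ultimately show ?thesis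
    unfolding mu_integral_def
    \<comment> \<open>The factorials of the block sizes cancel against the reciprocals in front of
      the integral.\<close>
    by (subst integral_antisymmetrized_eq_Delta[OF assms(2) sigma_finite_base_measure, where m = ?m])
       (auto simp: prod_dividef)
qed

end
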